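(* Let $n\ge 2$, let $H=[H_{i,j}]_{1\le i,j\le 2n}$ be a Bush-type Hadamard matrix of order $4n^2$ with blocks $H_{i,j}$ of size $2n\times 2n$, and let $\mathcal{D}$ be the symmetric $(4n^2,2n^2-n,n^2-n)$ design corresponding to $H$. For $1\le i\le 2n$ let $\mathcal{B}_i$ be the set of the $2n$ blocks of $\mathcal{D}$ corresponding to the rows of $H$ in the $i$-th block row $(H_{i,1},\dots,H_{i,2n})$. Then each $\mathcal{B}_i$ is a switching set of $\mathcal{D}$. Moreover, for every nonempty subset $S\subseteq\{1,\dots,2n\}$, one can switch successively with respect to the sets $\mathcal{B}_i$, $i\in S$ (each $\mathcal{B}_i$ being used once, and being a switching set of the design to which the switching is applied), and the resulting $2^{2n}-1$ incidence structures (one for each $S$) are symmetric $(4n^2,2n^2-n,n^2-n)$ designs, each of which also corresponds to a Bush-type Hadamard matrix of order $4n^2$.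
   Context: A Hadamard matrix of order $m$ is an $m\times m$ matrix $H$ with entries in $\{-1,1\}$ satisfying $HH^T=H^TH=mI_m$. A Bush-type Hadamard matrix of order $4n^2$ is a Hadamard matrix that is a block matrix $H=[H_{i,j}]_{1\le i,j\le 2n}$ with blocks of size $2n\times 2n$ such that $H_{i,i}=J_{2n}$ for all $i$ and $H_{i,j}J_{2n}=J_{2n}H_{i,j}=0$ for all $i\neq j$, where $J_{2n}$ is the all-ones $2n\times 2n$ matrix. A $2$-$(v,k,\lambda)$ design is a finite incidence structure $\mathcal{D}=(\mathcal{P},\mathcal{B},\mathcal{I})$, with $\mathcal{P}$ (points) and $\mathcal{B}$ (blocks) disjoint and $\mathcal{I}\subseteq\mathcal{P}\times\mathcal{B}$, such that $|\mathcal{P}|=v$, $1<k<v-1$, every block is incident with exactly $k$ points, and every two distinct points are together incident with exactly $\lambda$ blocks. It is a symmetric $(v,k,\lambda)$ design if moreover $|\mathcal{B}|=v$. The design corresponding to a Bush-type Hadamard matrix $H$ is the one whose block-by-point incidence matrix (rows indexed by blocks, columns by points) is obtained from $H$ by replacing each entry $1$ by $0$ and each entry $-1$ by $1$; for a Bush-type Hadamard matrix of order $4n^2$ this is a symmetric $(4n^2,2n^2-n,n^2-n)$ design. Switching set: a set of blocks $\mathcal{B}'\subset\mathcal{B}$ is a switching set of $\mathcal{D}$ if there are sets of points $\mathcal{P}_1,\mathcal{P}_2\subset\mathcal{P}$ such that: (1) $(P,B)\notin\mathcal{I}$ for every $(P,B)\in\mathcal{P}_1\times\mathcal{B}'$;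 (2) $(P,B)\in\mathcal{I}$ for every $(P,B)\in\mathcal{P}_2\times\mathcal{B}'$; (3) for every $P\in\mathcal{P}\setminus(\mathcal{P}_1\cup\mathcal{P}_2)$, the number of blocks of $\mathcal{B}'$ incident with $P$ equals the number of blocks of $\mathcal{B}'$ not incident with $P$. Switching with respect to $\mathcal{B}'$ replaces $\mathcal{I}$ by the incidence relation $\mathcal{I}'$ which agrees with $\mathcal{I}$ on all pairs $(P,B)$ with $B\notin\mathcal{B}'$ or $P\in\mathcal{P}_1\cup\mathcal{P}_2$, and is complementary to $\mathcal{I}$ (that is, $(P,B)\in\mathcal{I}'\Leftrightarrow(P,B)\notin\mathcal{I}$) on all pairs with $B\in\mathcal{B}'$ and $P\in\mathcal{P}\setminus(\mathcal{P}_1\cup\mathcal{P}_2)$. *)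

theory Defs
  imports "Jordan_Normal_Form.Matrix"
begin

definition hadamard_matrix :: "nat \<Rightarrow> int mat \<Rightarrow> bool" where
  "hadamard_matrix m H \<longleftrightarrow>
     H \<in> carrier_mat m m \<and> elements_mat H \<subseteq> {-1, 1} \<and>
     H * transpose_mat H = int m \<cdot>\<^sub>m 1\<^sub>m m \<and>
     transpose_mat H * H = int m \<cdot>\<^sub>m 1\<^sub>m m"

definition all_ones_mat :: "nat \<Rightarrow> int mat" where
  "all_ones_mat m = mat m m (\<lambda>_. 1)"

text \<open>Block indices, like matrix indices, start at 0.\<close>

definition block_of :: "nat \<Rightarrow> int mat \<Rightarrow> nat \<Rightarrow> nat \<Rightarrow> int mat" where
  "block_of s H i j = mat s s (\<lambda>(a, b). H $$ (s * i + a, s * j + b))"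

definition bush_type_hadamard :: "nat \<Rightarrow> int mat \<Rightarrow> bool" where
  "bush_type_hadamard n H \<longleftrightarrow>
     hadamard_matrix (4 * n\<^sup>2) H \<and>
     (\<forall>i<2 * n. block_of (2 * n) H i i = all_ones_mat (2 * n)) \<and>
     (\<forall>i<2 * n. \<forall>j<2 * n. i \<noteq> j \<longrightarrow>
        block_of (2 * n) H i j * all_ones_mat (2 * n) = 0\<^sub>m (2 * n) (2 * n) \<and>
        all_ones_mat (2 * n) * block_of (2 * n) H i j = 0\<^sub>m (2 * n) (2 * n))"

record 'a incidence =
  points :: "'a set"
  blocks :: "'a set"
  inc :: "('a \<times> 'a) set"

definition finite_incidence_structure :: "'a incidence \<Rightarrow> bool" where
  "finite_incidence_structure D \<longleftrightarrow>
     finite (points D) \<and> finite (blocks D) \<and> points D \<inter> blocks D = {} \<and>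
     inc D \<subseteq> points D \<times> blocks D"

definition two_design :: "'a incidence \<Rightarrow> nat \<Rightarrow> nat \<Rightarrow> nat \<Rightarrow> bool" where
  "two_design D v k l \<longleftrightarrow>
     finite_incidence_structure D \<and> card (points D) = v \<and> 1 < k \<and> k < v - 1 \<and>
     (\<forall>B\<in>blocks D. card {P \<in> points D. (P, B) \<in> inc D} = k) \<and>
     (\<forall>P\<in>points D. \<forall>Q\<in>points D. P \<noteq> Q \<longrightarrow>
        card {B \<in> blocks D. (P, B) \<in> inc D \<and> (Q, B) \<in> inc D} = l)"

definition symmetric_design :: "'a incidence \<Rightarrow> nat \<Rightarrow> nat \<Rightarrow> nat \<Rightarrow> bool" where
  "symmetric_design D v k l \<longleftrightarrow> two_design D v k l \<and> card (blocks D) = v"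

text \<open>The rows are indexed by the list \<open>bs\<close> of blocks, the columns by the list \<open>ps\<close> of points.\<close>

definition incidence_mat :: "'a incidence \<Rightarrow> 'a list \<Rightarrow> 'a list \<Rightarrow> int mat" where
  "incidence_mat D bs ps =
     mat (length bs) (length ps) (\<lambda>(r, c). if (ps ! c, bs ! r) \<in> inc D then 1 else 0)"

text \<open>\<open>D\<close> is the structure corresponding to the \<open>\<plusminus>1\<close> matrix \<open>H\<close>, where \<open>bs\<close> and \<open>ps\<close> list,
  without repetition, the blocks and points in the order of the rows and columns of \<open>H\<close>.\<close>

definition corresponds :: "'a incidence \<Rightarrow> 'a list \<Rightarrow> 'a list \<Rightarrow> int mat \<Rightarrow> bool" where
  "corresponds D bs ps H \<longleftrightarrow>
     finite_incidence_structure D \<and>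
     distinct bs \<and> set bs = blocks D \<and> distinct ps \<and> set ps = points D \<and>
     incidence_mat D bs ps = map_mat (\<lambda>x. if x = 1 then 0 else 1) H"

definition block_row :: "nat \<Rightarrow> 'a list \<Rightarrow> nat \<Rightarrow> 'a set" where
  "block_row s bs i = {bs ! r | r. s * i \<le> r \<and> r < s * (i + 1)}"

definition switching_data ::
  "'a incidence \<Rightarrow> 'a set \<Rightarrow> 'a set \<Rightarrow> 'a set \<Rightarrow> bool" where
  "switching_data D B' P1 P2 \<longleftrightarrow>
     B' \<subseteq> blocks D \<and> P1 \<subseteq> points D \<and> P2 \<subseteq> points D \<and>
     (\<forall>P\<in>P1. \<forall>B\<in>B'. (P, B) \<notin> inc D) \<and>
     (\<forall>P\<in>P2. \<forall>B\<in>B'. (P, B) \<in> inc D) \<and>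
     (\<forall>P\<in>points D - (P1 \<union> P2).
        card {B \<in> B'. (P, B) \<in> inc D} = card {B \<in> B'. (P, B) \<notin> inc D})"

definition switching_set :: "'a incidence \<Rightarrow> 'a set \<Rightarrow> bool" where
  "switching_set D B' \<longleftrightarrow> (\<exists>P1 P2. switching_data D B' P1 P2)"

definition switch :: "'a incidence \<Rightarrow> 'a set \<Rightarrow> 'a set \<Rightarrow> 'a set \<Rightarrow> 'a incidence" where
  "switch D B' P1 P2 = D\<lparr>inc := {(P, B). P \<in> points D \<and> B \<in> blocks D \<and>
     (if B \<notin> B' \<or> P \<in> P1 \<union> P2 then (P, B) \<in> inc D else (P, B) \<notin> inc D)}\<rparr>"

text \<open>\<open>switches_to D Bs D'\<close>: \<open>D'\<close> arises from \<open>D\<close> by switching with respect to the sets in the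
  list \<open>Bs\<close> one after the other, each being a switching set of the structure reached so far.\<close>

inductive switches_to :: "'a incidence \<Rightarrow> 'a set list \<Rightarrow> 'a incidence \<Rightarrow> bool" where
  Nil: "switches_to D [] D"
| Cons: "switching_data D B' P1 P2 \<Longrightarrow> switches_to (switch D B' P1 P2) Bs D' \<Longrightarrow>
    switches_to D (B' # Bs) D'"

end

theory Submission
  imports Defs
begin

text \<open>Switching with respect to the block row \<open>\<B>\<^sub>i\<close> negates all off-diagonal blocks of the
  \<open>i\<close>-th block row of \<open>H\<close>. This keeps the Hadamard property: an all-ones diagonal block is
  orthogonal to any off-diagonal block, since the latter has zero row and column sums, so
  block positions meeting the diagonal contribute nothing to the inner product of rows (or columns)
  of different block rows (or columns); on the remaining positions, negation changes row products
  by a common sign and does not change column products.\<close>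

section \<open>Index intervals cut out by blocks of size \<open>s\<close>\<close>

abbreviation interval :: "nat \<Rightarrow> nat \<Rightarrow> nat set" where
  "interval s j \<equiv> {j * s..<j * s + s}"

lemma interval_div:
  fixes s :: nat
  assumes "c \<in> interval s j"
  shows "c div s = j"
  using assms by (auto simp: mult.commute intro!: div_nat_eqI)

lemma mem_interval_div:
  fixes s :: nat
  assumes "s > 0"
  shows "c \<in> interval s (c div s)"
proof -
  have "c < c div s * s + s"
    using assms div_mult_mod_eq[of c s] mod_less_divisor[of s c] by linarith
  then show ?thesis by simp
qed

lemma interval_less:
  fixes s :: nat
  assumes "c \<in> interval s j" "j < m"
  shows "c < m * s"
proof -
  have "j * s + s \<le> m * s"
    using mult_le_mono1[of "Suc j" m s] assms(2) by simp
  then show ?thesis using assms(1) by auto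
qed

text \<open>Entries of \<open>block_of\<close> are addressed as \<open>s * j + b\<close>, whereas
  \<open>sum.nat_group\<close> splits sums along \<open>interval\<close>; this passes from one
  indexing to the other.\<close>

lemma sum_interval_shift:
  fixes f :: "nat \<Rightarrow> 'b::comm_monoid_add"
  shows "(\<Sum>b = 0..<s. f (s * j + b)) = sum f (interval s j)"
  using sum.shift_bounds_nat_ivl[of f 0 "j * s" s] by (simp add: ac_simps)

section \<open>The Bush-type property expressed through entries\<close>

lemma nat_sq_double: "4 * n\<^sup>2 = (2 * n) * (2 * n :: nat)"
  by (simp add: power2_eq_square)

text \<open>The matrix equations are replaced by sums over global indices, with \<open>div\<close>
  naming the block, so that a sign change can be followed entry by entry. The conjuncts are, in
  order: shape, signs, row orthogonality, column orthogonality, all-ones diagonal blocks, and zero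
  row and column sums of the other blocks.\<close>

definition bush_entries :: "nat \<Rightarrow> int mat \<Rightarrow> bool" where
  "bush_entries s H \<longleftrightarrow> H \<in> carrier_mat (s * s) (s * s) \<and>
     (\<forall>r<s * s. \<forall>c<s * s. H $$ (r, c) \<in> {-1, 1}) \<and>
     (\<forall>r<s * s. \<forall>q<s * s. (\<Sum>c<s * s. H $$ (r, c) * H $$ (q, c)) = (if r = q then int (s * s) else 0)) \<and>
     (\<forall>c<s * s. \<forall>d<s * s. (\<Sum>r<s * s. H $$ (r, c) * H $$ (r, d)) = (if c = d then int (s * s) else 0)) \<and>
     (\<forall>r<s * s. \<forall>c<s * s. r div s = c div s \<longrightarrow> H $$ (r, c) = 1) \<and>
     (\<forall>r<s * s. \<forall>j<s. r div s \<noteq> j \<longrightarrow> (\<Sum>c\<in>interval s j. H $$ (r, c)) = 0) \<and>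
     (\<forall>c<s * s. \<forall>i<s. c div s \<noteq> i \<longrightarrow> (\<Sum>r\<in>interval s i. H $$ (r, c)) = 0)"

lemma elements_mat_subset_iff:
  "elements_mat H \<subseteq> X \<longleftrightarrow> (\<forall>r<dim_row H. \<forall>c<dim_col H. H $$ (r, c) \<in> X)"
  by (fastforce simp: elements_mat_def)

text \<open>Division with remainder identifies indices below \<open>s * s\<close> with pairs of a
  block index and an offset. \<open>P\<close> receives the quotient as a separate argument so that a
  condition on \<open>r div s\<close> becomes one on the block index \<open>i\<close>.\<close>

lemma all_div_mod:
  fixes s :: nat
  shows "(\<forall>r<s * s. P (r div s) r) \<longleftrightarrow> (\<forall>i<s. \<forall>a<s. P i (s * i + a))"
proof (intro iffI allI impI)
  fix i a assume *: "\<forall>r<s * s. P (r div s) r" "i < s" "a < s"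
  have "s * i + a \<in> interval s i" using * by (auto simp: mult.commute)
  then show "P i (s * i + a)" using * interval_div interval_less by metis
next
  fix r assume *: "\<forall>i<s. \<forall>a<s. P i (s * i + a)" "r < s * s"
  then have "s > 0" by (cases s) auto
  then have "r div s < s" "r mod s < s"
    using * by (auto simp: less_mult_imp_div_less)
  then have "P (r div s) (s * (r div s) + r mod s)"
    using * by blast
  then show "P (r div s) r" by simp
qed

lemma bush_type_hadamard_iff_entries:
  assumes "n > 0"
  shows "bush_type_hadamard n H \<longleftrightarrow> bush_entries (2 * n) H"
proof -
  define s where "s = 2 * n"
  have s: "s > 0" using assms by (simp add: s_def)
  have N: "4 * n\<^sup>2 = s * s" by (simp add: s_def nat_sq_double)
  show ?thesis
  proof (cases "H \<in> carrier_mat (s * s) (s * s)")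
    case False
    then show ?thesis
      by (simp add: bush_type_hadamard_def bush_entries_def hadamard_matrix_def N s_def[symmetric])
  next
    case True
    then have dims: "dim_row H = s * s" "dim_col H = s * s" by auto
    have 1: "H * transpose_mat H = int (s * s) \<cdot>\<^sub>m 1\<^sub>m (s * s) \<longleftrightarrow>
       (\<forall>r<s * s. \<forall>q<s * s. (\<Sum>c<s * s. H $$ (r, c) * H $$ (q, c)) = (if r = q then int (s * s) else 0))"
      by (auto simp: mat_eq_iff dims scalar_prod_def atLeast0LessThan)
    have 2: "transpose_mat H * H = int (s * s) \<cdot>\<^sub>m 1\<^sub>m (s * s) \<longleftrightarrow>
       (\<forall>c<s * s. \<forall>d<s * s. (\<Sum>r<s * s. H $$ (r, c) * H $$ (r, d)) = (if c = d then int (s * s) else 0))"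
      by (auto simp: mat_eq_iff dims scalar_prod_def atLeast0LessThan)
    have diag: "(\<forall>r<s * s. \<forall>c<s * s. r div s = c div s \<longrightarrow> H $$ (r, c) = 1) \<longleftrightarrow>
       (\<forall>i<s. block_of s H i i = all_ones_mat s)"
    proof -
      \<comment> \<open>One use of \<open>all_div_mod\<close> splits the row index, the other the
        column index.\<close>
      have "(\<forall>r<s * s. \<forall>c<s * s. r div s = c div s \<longrightarrow> H $$ (r, c) = 1) \<longleftrightarrow>
        (\<forall>i<s. \<forall>a<s. \<forall>j<s. \<forall>b<s. i = j \<longrightarrow> H $$ (s * i + a, s * j + b) = 1)"
        using all_div_mod[of s "\<lambda>i r. \<forall>c<s * s. i = c div s \<longrightarrow> H $$ (r, c) = 1"]
          all_div_mod[of s "\<lambda>j c. i = j \<longrightarrow> H $$ (s * i + a, c) = 1" for i a]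
        by simp
      also have "\<dots> \<longleftrightarrow> (\<forall>i<s. \<forall>a<s. \<forall>b<s. H $$ (s * i + a, s * i + b) = 1)"
        by blast
      also have "\<dots> \<longleftrightarrow> (\<forall>i<s. block_of s H i i = all_ones_mat s)"
        by (auto simp: mat_eq_iff block_of_def all_ones_mat_def)
      finally show ?thesis .
    qed
    \<comment> \<open>Every column of a product with the all-ones matrix on the right is the vector
      of row sums; dually, on the left it produces column sums.\<close>
    have row: "block_of s H i j * all_ones_mat s = 0\<^sub>m s s \<longleftrightarrow>
       (\<forall>a<s. (\<Sum>c\<in>interval s j. H $$ (s * i + a, c)) = 0)" for i j
      using s by (auto simp: mat_eq_iff block_of_def all_ones_mat_def scalar_prod_def
          sum_interval_shift[of "\<lambda>c. H $$ (s * i + a, c)" for a])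
    have col: "all_ones_mat s * block_of s H i j = 0\<^sub>m s s \<longleftrightarrow>
       (\<forall>a<s. (\<Sum>r\<in>interval s i. H $$ (r, s * j + a)) = 0)" for i j
      using s by (auto simp: mat_eq_iff block_of_def all_ones_mat_def scalar_prod_def
          sum_interval_shift[of "\<lambda>r. H $$ (r, s * j + a)" for a])
    have rows: "(\<forall>r<s * s. \<forall>j<s. r div s \<noteq> j \<longrightarrow> (\<Sum>c\<in>interval s j. H $$ (r, c)) = 0) \<longleftrightarrow>
       (\<forall>i<s. \<forall>j<s. i \<noteq> j \<longrightarrow> block_of s H i j * all_ones_mat s = 0\<^sub>m s s)"
      unfolding row all_div_mod[where P = "\<lambda>i r. \<forall>j<s. i \<noteq> j \<longrightarrow> (\<Sum>c\<in>interval s j. H $$ (r, c)) = 0"]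
      by blast
    have cols: "(\<forall>c<s * s. \<forall>i<s. c div s \<noteq> i \<longrightarrow> (\<Sum>r\<in>interval s i. H $$ (r, c)) = 0) \<longleftrightarrow>
       (\<forall>i<s. \<forall>j<s. i \<noteq> j \<longrightarrow> all_ones_mat s * block_of s H i j = 0\<^sub>m s s)"
      unfolding col all_div_mod[where P = "\<lambda>j c. \<forall>i<s. j \<noteq> i \<longrightarrow> (\<Sum>r\<in>interval s i. H $$ (r, c)) = 0"]
      by blast
    show ?thesis
      unfolding bush_type_hadamard_def bush_entries_def hadamard_matrix_def N s_def[symmetric]
        elements_mat_subset_iff dims 1[symmetric] 2[symmetric] diag rows cols
      by blast
  qed
qed

section \<open>Negating the off-diagonal blocks in a set of block rows\<close>

definition flip_rows :: "nat \<Rightarrow> nat set \<Rightarrow> int mat \<Rightarrow> int mat" where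
  "flip_rows s S H = mat (dim_row H) (dim_col H)
     (\<lambda>(r, c). if r div s \<in> S \<and> r div s \<noteq> c div s then - H $$ (r, c) else H $$ (r, c))"

lemma flip_rows_empty [simp]: "flip_rows s {} H = H"
  by (auto simp: flip_rows_def)

text \<open>As \<open>i \<notin> S\<close>, no row is negated twice; for \<open>i \<in> S\<close>
  the two negations would cancel. This accumulates the effect of successive switchings.\<close>

lemma flip_rows_insert:
  "i \<notin> S \<Longrightarrow> flip_rows s S (flip_rows s {i} H) = flip_rows s (insert i S) H"
  by (auto simp: flip_rows_def)

lemma bush_entriesD:
  assumes "bush_entries s H"
  shows "H \<in> carrier_mat (s * s) (s * s)"
    and "\<And>r c. r < s * s \<Longrightarrow> c < s * s \<Longrightarrow> H $$ (r, c) \<in> {-1, 1}"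
    and "\<And>r q. r < s * s \<Longrightarrow> q < s * s \<Longrightarrow>
      (\<Sum>c<s * s. H $$ (r, c) * H $$ (q, c)) = (if r = q then int (s * s) else 0)"
    and "\<And>c d. c < s * s \<Longrightarrow> d < s * s \<Longrightarrow>
      (\<Sum>r<s * s. H $$ (r, c) * H $$ (r, d)) = (if c = d then int (s * s) else 0)"
    and "\<And>r c. r < s * s \<Longrightarrow> c < s * s \<Longrightarrow> r div s = c div s \<Longrightarrow> H $$ (r, c) = 1"
    and "\<And>r j. r < s * s \<Longrightarrow> j < s \<Longrightarrow> r div s \<noteq> j \<Longrightarrow> (\<Sum>c\<in>interval s j. H $$ (r, c)) = 0"
    and "\<And>c i. c < s * s \<Longrightarrow> i < s \<Longrightarrow> c div s \<noteq> i \<Longrightarrow> (\<Sum>r\<in>interval s i. H $$ (r, c)) = 0"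
  using assms unfolding bush_entries_def by simp_all

lemma bush_entries_flip_rows:
  assumes bush: "bush_entries s H"
  shows "bush_entries s (flip_rows s S H)"
proof (cases "s = 0")
  case True
  then show ?thesis using bush by (auto simp: bush_entries_def flip_rows_def)
next
  case False
  define K where "K = flip_rows s S H"
  define e :: "nat \<Rightarrow> int" where "e r = (if r div s \<in> S then -1 else 1)" for r
  note H = bush_entriesD(1)[OF bush] and pm = bush_entriesD(2)[OF bush]
    and ro = bush_entriesD(3)[OF bush] and co = bush_entriesD(4)[OF bush]
    and diag = bush_entriesD(5)[OF bush] and rs = bush_entriesD(6)[OF bush]
    and cs = bush_entriesD(7)[OF bush]
  have Kv: "K $$ (r, c) = (if r div s \<noteq> c div s then e r * H $$ (r, c) else H $$ (r, c))"
    if "r < s * s" "c < s * s" for r c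
    using that H by (auto simp: K_def flip_rows_def e_def)
  have Kdiag: "K $$ (r, c) = 1" if "r < s * s" "c < s * s" "r div s = c div s" for r c
    using that by (simp add: Kv diag)
  have lt: "x < s * s" if "x \<in> interval s j" "j < s" for x j
    using interval_less that by blast
  have Krs: "(\<Sum>c\<in>interval s j. K $$ (r, c)) = 0" if "r < s * s" "j < s" "r div s \<noteq> j" for r j
  proof -
    have "(\<Sum>c\<in>interval s j. K $$ (r, c)) = (\<Sum>c\<in>interval s j. e r * H $$ (r, c))"
      using that by (intro sum.cong refl) (simp add: Kv lt interval_div del: atLeastLessThan_iff)
    then show ?thesis using rs[OF that] by (simp add: sum_distrib_left[symmetric])
  qed
  have Kcs: "(\<Sum>r\<in>interval s i. K $$ (r, c)) = 0" if "c < s * s" "i < s" "c div s \<noteq> i" for c i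
  proof -
    \<comment> \<open>All rows of block row \<open>i\<close> carry the same sign, and column
      \<open>c\<close> meets them off the diagonal; the first row, \<open>i * s\<close>, serves as
      representative.\<close>
    have "(\<Sum>r\<in>interval s i. K $$ (r, c)) = (\<Sum>r\<in>interval s i. e (i * s) * H $$ (r, c))"
      using that False
      by (intro sum.cong refl) (auto simp: Kv lt interval_div e_def simp del: atLeastLessThan_iff)
    then show ?thesis using cs[OF that] by (simp add: sum_distrib_left[symmetric])
  qed
  \<comment> \<open>Row \<open>r\<close> is constantly 1 on its diagonal block, so the product sum
    is a row sum of row \<open>q\<close> over an off-diagonal block.\<close>
  have row_zero: "(\<Sum>c\<in>interval s (r div s). K $$ (r, c) * K $$ (q, c)) = 0"
    "(\<Sum>c\<in>interval s (r div s). H $$ (r, c) * H $$ (q, c)) = 0"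
    if "r < s * s" "q < s * s" "q div s \<noteq> r div s" for r q
  proof -
    have j: "r div s < s" using that(1) by (rule less_mult_imp_div_less)
    have "K $$ (r, c) = 1" "H $$ (r, c) = 1" if "c \<in> interval s (r div s)" for c
      using Kdiag diag lt[OF that j] interval_div[OF that] \<open>r < s * s\<close> by metis+
    then show "(\<Sum>c\<in>interval s (r div s). K $$ (r, c) * K $$ (q, c)) = 0"
      "(\<Sum>c\<in>interval s (r div s). H $$ (r, c) * H $$ (q, c)) = 0"
      using Krs[OF that(2) j that(3)] rs[OF that(2) j that(3)] by simp_all
  qed
  have col_zero: "(\<Sum>r\<in>interval s (c div s). K $$ (r, c) * K $$ (r, d)) = 0"
    "(\<Sum>r\<in>interval s (c div s). H $$ (r, c) * H $$ (r, d)) = 0"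
    if "c < s * s" "d < s * s" "d div s \<noteq> c div s" for c d
  proof -
    have j: "c div s < s" using that(1) by (rule less_mult_imp_div_less)
    have "K $$ (r, c) = 1" "H $$ (r, c) = 1" if "r \<in> interval s (c div s)" for r
      using Kdiag diag lt[OF that j] interval_div[OF that] \<open>c < s * s\<close> by metis+
    then show "(\<Sum>r\<in>interval s (c div s). K $$ (r, c) * K $$ (r, d)) = 0"
      "(\<Sum>r\<in>interval s (c div s). H $$ (r, c) * H $$ (r, d)) = 0"
      using Kcs[OF that(2) j that(3)] cs[OF that(2) j that(3)] by simp_all
  qed
  have Kro: "(\<Sum>c<s * s. K $$ (r, c) * K $$ (q, c)) = (if r = q then int (s * s) else 0)"
    if r: "r < s * s" and q: "q < s * s" for r q
  proof (cases "r div s = q div s")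
    case True
    \<comment> \<open>Within one block row both factors change sign at the same columns.\<close>
    have "(\<Sum>c<s * s. K $$ (r, c) * K $$ (q, c)) = (\<Sum>c<s * s. H $$ (r, c) * H $$ (q, c))"
      using True r q by (intro sum.cong refl) (auto simp: Kv e_def)
    then show ?thesis using ro[OF r q] by simp
  next
    case False
    \<comment> \<open>The factor \<open>e r * e q\<close> is the true sign change only away from the
      two diagonal blocks, but on those both sums vanish, so it can be used on every
      interval.\<close>
    have "(\<Sum>c\<in>interval s j. K $$ (r, c) * K $$ (q, c)) =
      e r * e q * (\<Sum>c\<in>interval s j. H $$ (r, c) * H $$ (q, c))" if j: "j < s" for j
    proof -
      consider "j = r div s" | "j = q div s" | "j \<noteq> r div s" "j \<noteq> q div s" by blast
      then show ?thesis
      proof cases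
        case 1
        then show ?thesis using row_zero[of r q] r q False by (simp add: mult.commute)
      next
        case 2
        then show ?thesis using row_zero[of q r] r q False by (simp add: mult.commute)
      next
        case 3
        then show ?thesis unfolding sum_distrib_left using r q j
          by (intro sum.cong refl) (simp add: Kv lt interval_div del: atLeastLessThan_iff)
      qed
    qed
    then have "(\<Sum>c<s * s. K $$ (r, c) * K $$ (q, c)) =
      e r * e q * (\<Sum>c<s * s. H $$ (r, c) * H $$ (q, c))"
      unfolding sum.nat_group[symmetric] sum_distrib_left by simp
    then show ?thesis using ro[OF r q] False by auto
  qed
  have Kco: "(\<Sum>r<s * s. K $$ (r, c) * K $$ (r, d)) = (if c = d then int (s * s) else 0)"
    if c: "c < s * s" and d: "d < s * s" for c d
  proof -
    have "(\<Sum>r\<in>interval s i. K $$ (r, c) * K $$ (r, d)) =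
      (\<Sum>r\<in>interval s i. H $$ (r, c) * H $$ (r, d))" if i: "i < s" for i
    proof -
      \<comment> \<open>If exactly one of the two columns meets its diagonal block, both sums
        vanish. Otherwise the terms agree: either nothing changes, or both factors carry the same
        sign, whose square is 1.\<close>
      consider "i = c div s" "i \<noteq> d div s" | "i = d div s" "i \<noteq> c div s"
        | "i = c div s \<longleftrightarrow> i = d div s" by blast
      then show ?thesis
      proof cases
        case 1
        then show ?thesis using col_zero[of c d] c d by (simp add: mult.commute)
      next
        case 2
        then show ?thesis using col_zero[of d c] c d by (simp add: mult.commute)
      next
        case 3
        then show ?thesis using c d i
          by (intro sum.cong refl)
            (auto simp: Kv lt interval_div e_def simp del: atLeastLessThan_iff)
      qed
    qed
    then have "(\<Sum>r<s * s. K $$ (r, c) * K $$ (r, d)) = (\<Sum>r<s * s. H $$ (r, c) * H $$ (r, d))"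
      unfolding sum.nat_group[symmetric] by simp
    then show ?thesis using co[OF c d] by simp
  qed
  have "K \<in> carrier_mat (s * s) (s * s)" using H by (simp add: K_def flip_rows_def)
  moreover have "K $$ (r, c) \<in> {-1, 1}" if "r < s * s" "c < s * s" for r c
    using pm[OF that] that by (auto simp: Kv e_def)
  ultimately show ?thesis
    unfolding bush_entries_def K_def[symmetric] using Kro Kco Kdiag Krs Kcs by blast
qed

section \<open>Incidence structures read off from sign matrices\<close>

definition design_of :: "'a list \<Rightarrow> 'a list \<Rightarrow> int mat \<Rightarrow> 'a incidence" where
  "design_of bs ps H = \<lparr>points = set ps, blocks = set bs,
     inc = {(ps ! c, bs ! r) | r c. r < length bs \<and> c < length ps \<and> H $$ (r, c) \<noteq> 1}\<rparr>"

lemma design_of_simps [simp]: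
  "points (design_of bs ps H) = set ps" "blocks (design_of bs ps H) = set bs"
  by (simp_all add: design_of_def)

lemma mem_inc_design_of:
  assumes "distinct bs" "distinct ps" "r < length bs" "c < length ps"
  shows "(ps ! c, bs ! r) \<in> inc (design_of bs ps H) \<longleftrightarrow> H $$ (r, c) \<noteq> 1"
  using assms by (auto simp: design_of_def nth_eq_iff_index_eq)

lemma incidence_eqI:
  fixes D E :: "'a incidence"
  assumes "points D = set ps" "blocks D = set bs" "inc D \<subseteq> set ps \<times> set bs"
    and "points E = set ps" "blocks E = set bs" "inc E \<subseteq> set ps \<times> set bs"
    and "\<And>r c. r < length bs \<Longrightarrow> c < length ps \<Longrightarrow>
      (ps ! c, bs ! r) \<in> inc D \<longleftrightarrow> (ps ! c, bs ! r) \<in> inc E"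
  shows "D = E"
proof -
  have "(P, B) \<in> inc D \<longleftrightarrow> (P, B) \<in> inc E" for P B
  proof (cases "P \<in> set ps \<and> B \<in> set bs")
    case True
    then obtain r c where "r < length bs" "c < length ps" "P = ps ! c" "B = bs ! r"
      by (metis in_set_conv_nth)
    then show ?thesis using assms(7) by simp
  next
    case False
    then show ?thesis using assms(3,6) by blast
  qed
  then have "inc D = inc E" by auto
  then show ?thesis using assms(1,2,4,5) by (simp add: incidence.equality)
qed

lemma inc_design_of_subset: "inc (design_of bs ps H) \<subseteq> set ps \<times> set bs"
  by (auto simp: design_of_def)

lemma corresponds_design_of:
  assumes "distinct bs" "distinct ps" "set ps \<inter> set bs = {}"
    and "H \<in> carrier_mat (length bs) (length ps)"
  shows "corresponds (design_of bs ps H) bs ps H"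
  using assms inc_design_of_subset[of bs ps H]
  by (auto simp: corresponds_def finite_incidence_structure_def incidence_mat_def mem_inc_design_of
      intro!: eq_matI)

text \<open>The lists and the 0/1 matrix determine the structure, so \<open>D\<close> may be
  replaced by an explicit function of \<open>H\<close>. The test \<open>\<noteq> 1\<close> in
  \<open>design_of\<close> mirrors the map in \<open>corresponds\<close>, which sends every entry
  other than 1 to 1.\<close>

lemma corresponds_imp_eq_design_of:
  assumes "corresponds D bs ps H"
  shows "D = design_of bs ps H"
    and "H \<in> carrier_mat (length bs) (length ps)"
proof -
  have eq: "incidence_mat D bs ps = map_mat (\<lambda>x. if x = 1 then 0 else 1) H"
    and fin: "finite_incidence_structure D"
    and d: "distinct bs" "distinct ps" and st: "set bs = blocks D" "set ps = points D"
    using assms by (auto simp: corresponds_def)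
  from arg_cong[OF eq, of dim_row] arg_cong[OF eq, of dim_col]
  show H: "H \<in> carrier_mat (length bs) (length ps)"
    by (auto simp: incidence_mat_def)
  have "(ps ! c, bs ! r) \<in> inc D \<longleftrightarrow> H $$ (r, c) \<noteq> 1" if "r < length bs" "c < length ps" for r c
    using arg_cong[OF eq, of "\<lambda>M. M $$ (r, c)"] that H
    by (auto simp: incidence_mat_def split: if_splits)
  then show "D = design_of bs ps H"
    using fin st d inc_design_of_subset[of bs ps H]
    by (intro incidence_eqI) (auto simp: finite_incidence_structure_def mem_inc_design_of)
qed

section \<open>Counting by sums of signs\<close>

lemma card_pm:
  fixes f :: "'b \<Rightarrow> int"
  assumes "finite A" "\<And>x. x \<in> A \<Longrightarrow> f x \<in> {-1, 1}"
  shows "2 * int (card {x \<in> A. f x \<noteq> 1}) = int (card A) - sum f A"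
    and "2 * int (card {x \<in> A. f x = 1}) = int (card A) + sum f A"
proof -
  have "2 * int (card {x \<in> A. f x \<noteq> 1}) = (\<Sum>x\<in>A. 2 * (if f x \<noteq> 1 then 1 else 0))"
    using assms(1) by (simp flip: sum_distrib_left add: sum.If_cases Int_def)
  \<comment> \<open>For a sign, (1 - f x) / 2 is the indicator of \<open>f x = -1\<close>.\<close>
  also have "\<dots> = (\<Sum>x\<in>A. 1 - f x)" using assms(2) by (intro sum.cong) auto
  finally show "2 * int (card {x \<in> A. f x \<noteq> 1}) = int (card A) - sum f A"
    by (simp add: sum_subtractf)
  have "2 * int (card {x \<in> A. f x = 1}) = (\<Sum>x\<in>A. 2 * (if f x = 1 then 1 else 0))"
    using assms(1) by (simp flip: sum_distrib_left add: sum.If_cases Int_def)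
  also have "\<dots> = (\<Sum>x\<in>A. 1 + f x)" using assms(2) by (intro sum.cong) fastforce+
  finally show "2 * int (card {x \<in> A. f x = 1}) = int (card A) + sum f A"
    by (simp add: sum.distrib)
qed

text \<open>The indicator of both signs being -1 is (1 - f x) (1 - g x) / 4; expanding the product
  gives the four terms.\<close>

lemma card_pm_pair:
  fixes f g :: "'b \<Rightarrow> int"
  assumes "finite A" "\<And>x. x \<in> A \<Longrightarrow> f x \<in> {-1, 1}" "\<And>x. x \<in> A \<Longrightarrow> g x \<in> {-1, 1}"
  shows "4 * int (card {x \<in> A. f x \<noteq> 1 \<and> g x \<noteq> 1}) =
    int (card A) - sum f A - sum g A + (\<Sum>x\<in>A. f x * g x)"
proof -
  have "4 * int (card {x \<in> A. f x \<noteq> 1 \<and> g x \<noteq> 1}) =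
    (\<Sum>x\<in>A. 4 * (if f x \<noteq> 1 \<and> g x \<noteq> 1 then 1 else 0))"
    using assms(1) by (simp flip: sum_distrib_left add: sum.If_cases Int_def)
  also have "\<dots> = (\<Sum>x\<in>A. 1 - f x - g x + f x * g x)"
    using assms(2,3) by (intro sum.cong refl) fastforce
  finally show ?thesis by (simp add: sum_subtractf sum.distrib)
qed

lemma card_set_nth:
  assumes "distinct xs"
  shows "card {x \<in> set xs. P x} = card {i \<in> {..<length xs}. P (xs ! i)}"
proof -
  have "card {x \<in> set xs. P x} = length (filter P xs)"
    using distinct_card[of "filter P xs"] assms by (simp add: Int_def)
  then show ?thesis by (simp add: length_filter_conv_card)
qed

lemma card_nth_subset:
  assumes "distinct xs" "A \<subseteq> {..<length xs}"
  shows "card {x \<in> (!) xs ` A. P x} = card {i \<in> A. P (xs ! i)}"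
proof -
  have "{x \<in> (!) xs ` A. P x} = (!) xs ` {i \<in> A. P (xs ! i)}" by auto
  moreover have "inj_on ((!) xs) {i \<in> A. P (xs ! i)}"
    using assms by (auto intro!: inj_on_nth)
  ultimately show ?thesis by (simp add: card_image)
qed

lemma nth_mem_image:
  assumes "distinct xs" "x < length xs" "A \<subseteq> {..<length xs}"
  shows "xs ! x \<in> (!) xs ` A \<longleftrightarrow> x \<in> A"
  using assms by (auto simp: nth_eq_iff_index_eq subset_iff)

text \<open>Yields the row and column sums of a Bush-type matrix: the diagonal block contributes
  \<open>s\<close>, the others nothing.\<close>

lemma sum_single_interval:
  fixes f :: "nat \<Rightarrow> int"
  assumes "i < s" "\<And>x. x \<in> interval s i \<Longrightarrow> f x = 1"
    and "\<And>j. j < s \<Longrightarrow> j \<noteq> i \<Longrightarrow> sum f (interval s j) = 0"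
  shows "(\<Sum>x<s * s. f x) = int s"
proof -
  have "(\<Sum>x<s * s. f x) = (\<Sum>j<s. sum f (interval s j))"
    by (simp add: sum.nat_group)
  also have "\<dots> = (\<Sum>j\<in>{i}. sum f (interval s j))"
    using assms by (intro sum.mono_neutral_right) auto
  also have "\<dots> = int s" using assms(2) by simp
  finally show ?thesis .
qed

section \<open>Block rows as index images, and unfolding of switching sequences\<close>

lemma block_row_eq_image: "block_row s bs i = (!) bs ` interval s i"
  by (auto simp: block_row_def mult.commute)

lemma switches_to_Nil_iff: "switches_to D [] D' \<longleftrightarrow> D' = D"
  by (subst switches_to.simps) auto

text \<open>Stated as an equivalence so that one induction yields both existence and uniqueness of
  the outcome.\<close>

lemma switches_to_Cons_iff:
  "switches_to D (B' # Bs) D' \<longleftrightarrow>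
    (\<exists>P1 P2. switching_data D B' P1 P2 \<and> switches_to (switch D B' P1 P2) Bs D')"
  by (subst switches_to.simps) auto

section \<open>Designs of Bush-type matrices over fixed lists of blocks and points, and their
  switchings\<close>

locale bush_indexing =
  fixes n :: nat and bs ps :: "'a list"
  assumes n: "n \<ge> 2" and distinct: "distinct bs" "distinct ps"
    and disjoint: "set ps \<inter> set bs = {}"
    and lengths: "length bs = (2 * n) * (2 * n)" "length ps = (2 * n) * (2 * n)"
begin

definition s where "s = 2 * n"

lemma lens: "length bs = s * s" "length ps = s * s"
  using lengths by (simp_all add: s_def)

lemma s_pos: "s > 0" using n by (simp add: s_def)

lemma ex_point_index: "P \<in> set ps \<Longrightarrow> \<exists>c<s * s. P = ps ! c"
  and ex_block_index: "B \<in> set bs \<Longrightarrow> \<exists>r<s * s. B = bs ! r"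
  unfolding in_set_conv_nth lens by blast+

lemma inc_iff:
  "r < s * s \<Longrightarrow> c < s * s \<Longrightarrow>
    (ps ! c, bs ! r) \<in> inc (design_of bs ps H) \<longleftrightarrow> H $$ (r, c) \<noteq> 1"
  using mem_inc_design_of[OF distinct] lens by simp

lemma interval_subset: "i < s \<Longrightarrow> interval s i \<subseteq> {..<s * s}"
  by (meson interval_less lessThan_iff subsetI)

text \<open>All rows and columns of \<open>H\<close> sum to \<open>s = 2 * n\<close>. Hence a row
  has (s^2 - s) / 2 entries -1, and, distinct columns being orthogonal, two of them share (s^2 - 2
  s) / 4 positions with entry -1.\<close>

lemma symmetric_design_design_of:
  assumes "bush_entries s H"
  shows "symmetric_design (design_of bs ps H) (4 * n\<^sup>2) (2 * n\<^sup>2 - n) (n\<^sup>2 - n)"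
proof -
  note pm = bush_entriesD(2)[OF assms] and co = bush_entriesD(4)[OF assms]
    and diag = bush_entriesD(5)[OF assms] and rs = bush_entriesD(6)[OF assms]
    and cs = bush_entriesD(7)[OF assms]
  let ?D = "design_of bs ps H"
  have sq: "n \<le> n\<^sup>2" "2 * n \<le> n\<^sup>2"
    using n by (simp_all add: power2_eq_square)
  have N: "s * s = 4 * n\<^sup>2" by (simp add: s_def nat_sq_double)
  have lt: "x < s * s" if "x \<in> interval s j" "j < s" for x j
    using interval_less that by blast
  have rsum: "(\<Sum>c<s * s. H $$ (r, c)) = int s" if "r < s * s" for r
    using that lt[OF _ less_mult_imp_div_less[OF that]]
    by (intro sum_single_interval[of "r div s"])
      (auto simp: less_mult_imp_div_less interval_div rs simp del: atLeastLessThan_iff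
        intro!: diag)
  have csum: "(\<Sum>r<s * s. H $$ (r, c)) = int s" if "c < s * s" for c
    using that lt[OF _ less_mult_imp_div_less[OF that]]
    by (intro sum_single_interval[of "c div s"])
      (auto simp: less_mult_imp_div_less interval_div cs simp del: atLeastLessThan_iff
        intro!: diag)
  have k: "card {P \<in> set ps. (P, B) \<in> inc ?D} = 2 * n\<^sup>2 - n" if B: "B \<in> set bs" for B
  proof -
    obtain r where r: "r < s * s" "B = bs ! r"
      using ex_block_index[OF B] by blast
    have "{c \<in> {..<length ps}. (ps ! c, B) \<in> inc ?D} = {c \<in> {..<s * s}. H $$ (r, c) \<noteq> 1}"
      using inc_iff[OF r(1)] r(2) lens(2) by auto
    then have "card {P \<in> set ps. (P, B) \<in> inc ?D} = card {c \<in> {..<s * s}. H $$ (r, c) \<noteq> 1}"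
      by (simp only: card_set_nth[OF distinct(2)])
    \<comment> \<open>The additive form returns to \<open>nat\<close> without truncated
      subtraction.\<close>
    moreover have "int (2 * card {c \<in> {..<s * s}. H $$ (r, c) \<noteq> 1} + s) = int (s * s)"
      using card_pm(1)[of "{..<s * s}" "\<lambda>c. H $$ (r, c)"] pm r rsum by simp
    ultimately have "2 * card {P \<in> set ps. (P, B) \<in> inc ?D} + 2 * n = 4 * n\<^sup>2"
      unfolding of_nat_eq_iff N by (simp add: s_def)
    then show ?thesis by linarith
  qed
  have l: "card {B \<in> set bs. (P, B) \<in> inc ?D \<and> (Q, B) \<in> inc ?D} = n\<^sup>2 - n"
    if PQ: "P \<in> set ps" "Q \<in> set ps" "P \<noteq> Q" for P Q
  proof -
    obtain c d where c: "c < s * s" "P = ps ! c" and d: "d < s * s" "Q = ps ! d"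
      using ex_point_index[OF PQ(1)] ex_point_index[OF PQ(2)] by blast
    have "c \<noteq> d" using PQ(3) c d by auto
    have "{r \<in> {..<length bs}. (P, bs ! r) \<in> inc ?D \<and> (Q, bs ! r) \<in> inc ?D} =
      {r \<in> {..<s * s}. H $$ (r, c) \<noteq> 1 \<and> H $$ (r, d) \<noteq> 1}"
      using inc_iff[OF _ c(1)] inc_iff[OF _ d(1)] c(2) d(2) lens(1) by auto
    then have "card {B \<in> set bs. (P, B) \<in> inc ?D \<and> (Q, B) \<in> inc ?D} =
      card {r \<in> {..<s * s}. H $$ (r, c) \<noteq> 1 \<and> H $$ (r, d) \<noteq> 1}"
      by (simp only: card_set_nth[OF distinct(1)])
    moreover have "int (4 * card {r \<in> {..<s * s}. H $$ (r, c) \<noteq> 1 \<and> H $$ (r, d) \<noteq> 1} + s + s) =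
      int (s * s)"
      using card_pm_pair[of "{..<s * s}" "\<lambda>r. H $$ (r, c)" "\<lambda>r. H $$ (r, d)"]
        pm c d csum co[of c d] \<open>c \<noteq> d\<close> by simp
    ultimately have "4 * card {B \<in> set bs. (P, B) \<in> inc ?D \<and> (Q, B) \<in> inc ?D} + 4 * n = 4 * n\<^sup>2"
      unfolding of_nat_eq_iff N by (simp add: s_def)
    then show ?thesis by linarith
  qed
  have "finite_incidence_structure ?D"
    using disjoint inc_design_of_subset by (simp add: finite_incidence_structure_def)
  moreover have "card (set ps) = 4 * n\<^sup>2" "card (set bs) = 4 * n\<^sup>2"
    using distinct lens N by (simp_all add: distinct_card)
  moreover have "1 < 2 * n\<^sup>2 - n" "2 * n\<^sup>2 - n < 4 * n\<^sup>2 - 1" using sq n by linarith+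
  ultimately show ?thesis
    using k l by (simp add: symmetric_design_def two_design_def)
qed

text \<open>A point outside the diagonal interval is on some blocks of the block row and off others,
  so it lies in neither set; a point inside is on none of them, so it must lie in \<open>P1\<close>.
  As the point sets are forced, switching a block row has only one outcome.\<close>

lemma switching_data_block_row_iff:
  assumes "bush_entries s H" and i: "i < s"
  shows "switching_data (design_of bs ps H) (block_row s bs i) P1 P2 \<longleftrightarrow>
    P1 = (!) ps ` interval s i \<and> P2 = {}"
proof -
  note pm = bush_entriesD(2)[OF assms(1)] and diag = bush_entriesD(5)[OF assms(1)]
    and cs = bush_entriesD(7)[OF assms(1)]
  let ?D = "design_of bs ps H" and ?B = "(!) bs ` interval s i"
  note sub = interval_subset[OF i]
  have none: "(ps ! c, B) \<notin> inc ?D" if cB: "c \<in> interval s i" "B \<in> ?B" for c B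
  proof -
    obtain r where r: "r \<in> interval s i" "B = bs ! r" using cB(2) by blast
    have lt: "r < s * s" "c < s * s" using cB(1) r(1) sub by blast+
    have "H $$ (r, c) = 1"
      using diag[OF lt] interval_div[OF r(1)] interval_div[OF cB(1)] by simp
    then show ?thesis using inc_iff[OF lt] r(2) by simp
  qed
  have cards: "card {B \<in> ?B. (ps ! c, B) \<in> inc ?D} = card {r \<in> interval s i. H $$ (r, c) \<noteq> 1}"
    "card {B \<in> ?B. (ps ! c, B) \<notin> inc ?D} = card {r \<in> interval s i. H $$ (r, c) = 1}"
    if "c < s * s" for c
  proof -
    have "{r \<in> interval s i. (ps ! c, bs ! r) \<in> inc ?D} = {r \<in> interval s i. H $$ (r, c) \<noteq> 1}"
      "{r \<in> interval s i. (ps ! c, bs ! r) \<notin> inc ?D} = {r \<in> interval s i. H $$ (r, c) = 1}"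
      using inc_iff[OF _ that] sub by blast+
    moreover have "interval s i \<subseteq> {..<length bs}" using sub lens(1) by simp
    ultimately show "card {B \<in> ?B. (ps ! c, B) \<in> inc ?D} = card {r \<in> interval s i. H $$ (r, c) \<noteq> 1}"
      "card {B \<in> ?B. (ps ! c, B) \<notin> inc ?D} = card {r \<in> interval s i. H $$ (r, c) = 1}"
      by (simp_all only: card_nth_subset[OF distinct(1)])
  qed
  \<comment> \<open>The column sums to zero on this off-diagonal block, so 1 and -1 occur equally
    often.\<close>
  have bal: "2 * card {B \<in> ?B. (ps ! c, B) \<in> inc ?D} = s"
    "2 * card {B \<in> ?B. (ps ! c, B) \<notin> inc ?D} = s"
    if "c < s * s" "c \<notin> interval s i" for c
  proof -
    have "c div s \<noteq> i" using that mem_interval_div[OF s_pos, of c] by auto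
    moreover have "\<And>r. r \<in> interval s i \<Longrightarrow> H $$ (r, c) \<in> {-1, 1}"
      using sub pm that by blast
    ultimately have "2 * int (card {r \<in> interval s i. H $$ (r, c) \<noteq> 1}) = int s"
      "2 * int (card {r \<in> interval s i. H $$ (r, c) = 1}) = int s"
      using card_pm[of "interval s i" "\<lambda>r. H $$ (r, c)"] cs[OF that(1) i] by simp_all
    then show "2 * card {B \<in> ?B. (ps ! c, B) \<in> inc ?D} = s"
      "2 * card {B \<in> ?B. (ps ! c, B) \<notin> inc ?D} = s"
      unfolding cards[OF that(1)] by linarith+
  qed
  have Bsub: "?B \<subseteq> set bs" "(!) ps ` interval s i \<subseteq> set ps"
    using sub lens by (auto simp: subset_iff)
  \<comment> \<open>Here the counts are 0 and \<open>s\<close>, which rules out the balance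
    condition for points inside.\<close>
  have unbal: "card {B \<in> ?B. (ps ! c, B) \<in> inc ?D} \<noteq> card {B \<in> ?B. (ps ! c, B) \<notin> inc ?D}"
    if "c \<in> interval s i" for c
  proof -
    have "{B \<in> ?B. (ps ! c, B) \<in> inc ?D} = {}" "{B \<in> ?B. (ps ! c, B) \<notin> inc ?D} = ?B"
      using none[OF that] by blast+
    moreover have "card ?B \<noteq> 0" using s_pos by simp
    ultimately show ?thesis by (metis card.empty)
  qed
  show ?thesis
    unfolding block_row_eq_image
  proof
    assume "switching_data ?D ?B P1 P2"
    then have P: "P1 \<subseteq> set ps" "P2 \<subseteq> set ps"
      and P1: "\<And>P B. P \<in> P1 \<Longrightarrow> B \<in> ?B \<Longrightarrow> (P, B) \<notin> inc ?D"
      and P2: "\<And>P B. P \<in> P2 \<Longrightarrow> B \<in> ?B \<Longrightarrow> (P, B) \<in> inc ?D"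
      and rest: "\<And>P. P \<in> set ps - (P1 \<union> P2) \<Longrightarrow>
        card {B \<in> ?B. (P, B) \<in> inc ?D} = card {B \<in> ?B. (P, B) \<notin> inc ?D}"
      unfolding switching_data_def by auto
    have ne: "?B \<noteq> {}" using s_pos by auto
    have outside: "ps ! c \<notin> P1 \<union> P2" if c: "c < s * s" "c \<notin> interval s i" for c
    proof -
      have "{B \<in> ?B. (ps ! c, B) \<in> inc ?D} \<noteq> {}" "{B \<in> ?B. (ps ! c, B) \<notin> inc ?D} \<noteq> {}"
        using bal[OF c] s_pos by (metis card.empty mult_0_right less_not_refl)+
      then show ?thesis using P1 P2 by blast
    qed
    have inside: "ps ! c \<in> P1" "ps ! c \<notin> P2" if c: "c \<in> interval s i" for c
    proof -
      show "ps ! c \<notin> P2" using P2 none[OF c] ne by blast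
      moreover have "ps ! c \<in> set ps" using Bsub(2) c by blast
      ultimately show "ps ! c \<in> P1" using rest unbal[OF c] by blast
    qed
    have "P1 \<subseteq> (!) ps ` interval s i"
    proof
      fix P assume "P \<in> P1"
      moreover from this obtain c where "c < s * s" "P = ps ! c"
        using P(1) ex_point_index by blast
      ultimately show "P \<in> (!) ps ` interval s i" using outside by blast
    qed
    moreover have "P2 = {}"
    proof (rule ccontr)
      assume "P2 \<noteq> {}"
      then obtain P where "P \<in> P2" by blast
      moreover from this obtain c where "c < s * s" "P = ps ! c"
        using P(2) ex_point_index by blast
      ultimately show False using outside inside(2) by blast
    qed
    ultimately show "P1 = (!) ps ` interval s i \<and> P2 = {}" using inside(1) by blast
  next
    assume *: "P1 = (!) ps ` interval s i \<and> P2 = {}"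
    have "card {B \<in> ?B. (P, B) \<in> inc ?D} = card {B \<in> ?B. (P, B) \<notin> inc ?D}"
      if P: "P \<in> set ps" "P \<notin> (!) ps ` interval s i" for P
    proof -
      obtain c where c: "c < s * s" "P = ps ! c" using ex_point_index[OF P(1)] by blast
      then have "c \<notin> interval s i" using P(2) by blast
      then show ?thesis using bal c by fastforce
    qed
    then show "switching_data ?D ?B P1 P2"
      using * Bsub none unfolding switching_data_def by auto
  qed
qed

text \<open>Complementing incidence negates a sign, and the points kept fixed are the columns of the
  diagonal block.\<close>

lemma switch_design_of:
  assumes bush: "bush_entries s H" and i: "i < s"
  shows "switch (design_of bs ps H) (block_row s bs i) ((!) ps ` interval s i) {} =
    design_of bs ps (flip_rows s {i} H)"
    (is "?L = ?R")
proof (rule incidence_eqI[of _ ps bs])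
  fix r c assume rc: "r < length bs" "c < length ps"
  then have lt: "r < s * s" "c < s * s" using lens by auto
  have H: "H \<in> carrier_mat (s * s) (s * s)" and pm: "H $$ (r, c) \<in> {-1, 1}"
    using bush_entriesD(1,2)[OF bush] lt by blast+
  have B: "bs ! r \<in> block_row s bs i \<longleftrightarrow> r div s = i"
    unfolding block_row_eq_image
    using nth_mem_image[OF distinct(1) rc(1)] interval_subset[OF i] lens
      interval_div mem_interval_div[OF s_pos, of r] by metis
  have P: "ps ! c \<in> (!) ps ` interval s i \<longleftrightarrow> c div s = i"
    using nth_mem_image[OF distinct(2) rc(2)] interval_subset[OF i] lens
      interval_div mem_interval_div[OF s_pos, of c] by metis
  \<comment> \<open>As the entry is a sign, its negation differs from 1 exactly when the entry
    itself is 1.\<close>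
  show "(ps ! c, bs ! r) \<in> inc ?L \<longleftrightarrow> (ps ! c, bs ! r) \<in> inc ?R"
    using rc lt pm H by (auto simp: switch_def B P inc_iff flip_rows_def)
qed (use inc_design_of_subset in \<open>auto simp: switch_def\<close>)

text \<open>Each switch leaves a Bush-type matrix, so the induction, with \<open>H\<close>
  arbitrary, can go on to the next block row. The outcome involves only \<open>set is\<close>, hence
  not the order of switching.\<close>

lemma switches_to_block_rows_iff:
  assumes "bush_entries s H" "distinct is" "set is \<subseteq> {..<s}"
  shows "switches_to (design_of bs ps H) (map (block_row s bs) is) D' \<longleftrightarrow>
    D' = design_of bs ps (flip_rows s (set is) H)"
  using assms
proof (induction "is" arbitrary: H)
  case Nil
  then show ?case by (simp add: switches_to_Nil_iff)
next
  case (Cons i "is")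
  then have i: "i < s" by simp
  have "switches_to (design_of bs ps H) (map (block_row s bs) (i # is)) D' \<longleftrightarrow>
    (\<exists>P1 P2. switching_data (design_of bs ps H) (block_row s bs i) P1 P2 \<and>
      switches_to (switch (design_of bs ps H) (block_row s bs i) P1 P2) (map (block_row s bs) is) D')"
    by (simp add: switches_to_Cons_iff)
  also have "\<dots> \<longleftrightarrow> switches_to (design_of bs ps (flip_rows s {i} H)) (map (block_row s bs) is) D'"
    using switching_data_block_row_iff[OF Cons.prems(1) i] switch_design_of[OF Cons.prems(1) i]
    by simp
  also have "\<dots> \<longleftrightarrow> D' = design_of bs ps (flip_rows s (set is) (flip_rows s {i} H))"
    using Cons bush_entries_flip_rows by simp
  also have "flip_rows s (set is) (flip_rows s {i} H) = flip_rows s (set (i # is)) H"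
    using Cons.prems by (simp add: flip_rows_insert)
  finally show ?case .
qed

text \<open>Whether \<open>i \<in> S\<close> can be recovered from a single off-diagonal entry in
  block row \<open>i\<close>, since negation always changes a sign.\<close>

lemma inj_on_design_of_flip_rows:
  assumes "bush_entries s H"
  shows "inj_on (\<lambda>S. design_of bs ps (flip_rows s S H)) (Pow {..<s})"
proof (rule inj_onI)
  fix S T assume S: "S \<in> Pow {..<s}" and T: "T \<in> Pow {..<s}"
    and eq: "design_of bs ps (flip_rows s S H) = design_of bs ps (flip_rows s T H)"
  have "i \<in> S \<longleftrightarrow> i \<in> T" if i: "i < s" for i
  proof -
    \<comment> \<open>Any block index other than \<open>i\<close> would do; the entry tested is the
      top left one of block \<open>(i, j)\<close>.\<close>
    define j :: nat where "j = (if i = 0 then 1 else 0)"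
    have j: "j < s" "j \<noteq> i" using n by (auto simp: j_def s_def)
    have mem: "i * s \<in> interval s i" "j * s \<in> interval s j" using s_pos by auto
    then have lt: "i * s < s * s" "j * s < s * s" using interval_less i j(1) by blast+
    have dv: "i * s div s = i" "j * s div s = j" using s_pos by auto
    have H: "H \<in> carrier_mat (s * s) (s * s)" and pm: "H $$ (i * s, j * s) \<in> {-1, 1}"
      using bush_entriesD(1,2)[OF assms] lt by blast+
    have "(flip_rows s S H $$ (i * s, j * s) \<noteq> 1) = (flip_rows s T H $$ (i * s, j * s) \<noteq> 1)"
      using inc_iff[OF lt] eq by metis
    then show ?thesis using pm H lt dv j(2) by (auto simp: flip_rows_def split: if_splits)
  qed
  then show "S = T" using S T by auto
qed

end

section \<open>Switching over all nonempty sets of block rows\<close>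

theorem mainTheorem2:
  fixes n :: nat and H :: "int mat" and D :: "'a incidence" and bs ps :: "'a list"
  assumes "n \<ge> 2"
    and "bush_type_hadamard n H"
    and "corresponds D bs ps H"
  shows "symmetric_design D (4 * n\<^sup>2) (2 * n\<^sup>2 - n) (n\<^sup>2 - n) \<and>
    (\<forall>i<2 * n. card (block_row (2 * n) bs i) = 2 * n \<and>
       switching_set D (block_row (2 * n) bs i)) \<and>
    (\<exists>E :: nat set \<Rightarrow> 'a incidence.
       (\<forall>S. S \<noteq> {} \<and> S \<subseteq> {..<2 * n} \<longrightarrow>
          (\<forall>is. distinct is \<and> set is = S \<longrightarrow>
             (\<forall>D'. switches_to D (map (block_row (2 * n) bs) is) D' \<longleftrightarrow> D' = E S)) \<and>
          symmetric_design (E S) (4 * n\<^sup>2) (2 * n\<^sup>2 - n) (n\<^sup>2 - n) \<and>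
          (\<exists>H'. bush_type_hadamard n H' \<and> corresponds (E S) bs ps H')) \<and>
       card (E ` {S. S \<noteq> {} \<and> S \<subseteq> {..<2 * n}}) = 2 ^ (2 * n) - 1)"
proof -
  have n0: "n > 0" using assms(1) by simp
  have bush: "bush_entries (2 * n) H"
    using assms(2) bush_type_hadamard_iff_entries[OF n0] by blast
  note D = corresponds_imp_eq_design_of[OF assms(3)]
  have H: "H \<in> carrier_mat ((2 * n) * (2 * n)) ((2 * n) * (2 * n))"
    using bush by (simp add: bush_entries_def)
  interpret bush_indexing n bs ps
    using assms(1,3) D(2) H
    by unfold_locales (auto simp: corresponds_def finite_incidence_structure_def)
  note bush = bush[folded s_def]
  \<comment> \<open>The outcome is given directly by the set \<open>S\<close>, so it serves every
    enumeration of \<open>S\<close> at once.\<close>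
  define E where "E S = design_of bs ps (flip_rows s S H)" for S
  have "card (block_row s bs i) = s" if "i < s" for i
  proof -
    have "inj_on ((!) bs) (interval s i)"
      using interval_subset[OF that] lens(1) by (intro inj_on_nth distinct(1)) auto
    then show ?thesis by (simp add: block_row_eq_image card_image)
  qed
  moreover have "switching_set D (block_row s bs i)" if "i < s" for i
    using switching_data_block_row_iff[OF bush that] D(1) unfolding switching_set_def by blast
  moreover have "switches_to D (map (block_row s bs) is) D' \<longleftrightarrow> D' = E S"
    if "S \<subseteq> {..<s}" "distinct is" "set is = S" for S "is" D'
    using switches_to_block_rows_iff[OF bush that(2)] that D(1) unfolding E_def by blast
  moreover have "symmetric_design (E S) (4 * n\<^sup>2) (2 * n\<^sup>2 - n) (n\<^sup>2 - n)" for S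
    unfolding E_def by (intro symmetric_design_design_of bush_entries_flip_rows bush)
  moreover have "\<exists>H'. bush_type_hadamard n H' \<and> corresponds (E S) bs ps H'" for S
  proof (intro exI conjI)
    show "bush_type_hadamard n (flip_rows s S H)"
      using bush_entries_flip_rows[OF bush] bush_type_hadamard_iff_entries[OF n0] s_def by simp
    show "corresponds (E S) bs ps (flip_rows s S H)"
      unfolding E_def using distinct disjoint D(2)
      by (intro corresponds_design_of) (auto simp: flip_rows_def)
  qed
  moreover have "card (E ` {S. S \<noteq> {} \<and> S \<subseteq> {..<s}}) = 2 ^ s - 1"
  proof -
    \<comment> \<open>By injectivity the distinct outcomes are as many as the nonempty
      subsets.\<close>
    have "{S. S \<noteq> {} \<and> S \<subseteq> {..<s}} = Pow {..<s} - {{}}" by auto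
    moreover have "inj_on E (Pow {..<s} - {{}})"
      using inj_on_design_of_flip_rows[OF bush] unfolding E_def[abs_def]
      by (rule inj_on_subset) auto
    ultimately show ?thesis by (simp add: card_image card_Pow card_Diff_singleton)
  qed
  moreover have "symmetric_design D (4 * n\<^sup>2) (2 * n\<^sup>2 - n) (n\<^sup>2 - n)"
    using symmetric_design_design_of[OF bush] D(1) by simp
  ultimately show ?thesis
    unfolding s_def[symmetric] by (intro conjI exI[of _ E] allI impI) auto
qed

end
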